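(* Let $\mathcal{G}$ be a geometric algebra, $r,s\ge 0$, $A_r$ an $r$-vector and $B_s$ an $s$-vector. Then the geometric product $A_rB_s$ consists of $\min\{r,s\}+1$ terms of grades $|r-s|,\ |r-s|+2,\ |r-s|+4,\dotsc,\ r+s$; that is, $$A_rB_s=\sum_{j=0}^{\min\{r,s\}}\langle A_rB_s\rangle_{|r-s|+2j}.$$
   Context: A geometric algebra $\mathcal{G}$ is a ring with unit containing a field $\mathcal{G}_0$ of characteristic zero (the scalars, with $0,1\in\mathcal{G}_0$) and a subset $\mathcal{G}_1$ (the vectors) closed under addition with $\lambda v=v\lambda\in\mathcal{G}_1$ for all $\lambda\in\mathcal{G}_0$, $v\in\mathcal{G}_1$ (so $\mathcal{G}_1$ is a $\mathcal{G}_0$-vector space), such that: the square of every vector is a scalar; the symmetric bilinear inner product of vectors $u\rfloor v:=\frac12(uv+vu)\in\mathcal{G}_0$ is nondegenerate (the only vector orthogonal to all vectors is $0$); and $\mathcal{G}$ is the direct sum of the subspaces $\mathcal{G}_r$, $r\ge 0$, defined as follows. Vectors $u,v$ are orthogonal if $u\rfloor v=0$. For $r\ge 2$ an $r$-blade is a product of $r$ pairwise orthogonal vectors; $0$-blades are the scalars and $1$-blades the vectors. An $r$-vector is a finite sum of $r$-blades, and $\mathcal{G}_r$ is the set of $r$-vectors. $\langle A\rangle_r$ denotes the component of $A\in\mathcal{G}$ in $\mathcal{G}_r$. *)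

theory Defs
  imports Main
begin

text \<open>
  The ambient algebra is the type \<open>'a\<close> itself; \<open>K\<close> is the set of scalars and \<open>V\<close> the set of
  vectors. As \<open>'a\<close> is only a ring, the factor 1/2 in the inner product has to be taken in the
  field \<open>K\<close>.
\<close>

definition scalar_inverse :: "'a::ring_1 set \<Rightarrow> 'a \<Rightarrow> 'a" where
  "scalar_inverse K x = (THE y. y \<in> K \<and> x * y = 1)"

definition vec_inner :: "'a::ring_1 set \<Rightarrow> 'a \<Rightarrow> 'a \<Rightarrow> 'a" where
  "vec_inner K u v = scalar_inverse K 2 * (u * v + v * u)"

definition vec_orthogonal :: "'a::ring_1 set \<Rightarrow> 'a \<Rightarrow> 'a \<Rightarrow> bool" where
  "vec_orthogonal K u v \<longleftrightarrow> vec_inner K u v = 0"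

definition blades :: "'a::ring_1 set \<Rightarrow> 'a set \<Rightarrow> nat \<Rightarrow> 'a set" where
  "blades K V r =
     (if r = 0 then K
      else if r = 1 then V
      else {prod_list vs | vs. length vs = r \<and> set vs \<subseteq> V \<and>
              (\<forall>i<r. \<forall>j<r. i \<noteq> j \<longrightarrow> vec_orthogonal K (vs ! i) (vs ! j))})"

definition multivectors :: "'a::ring_1 set \<Rightarrow> 'a set \<Rightarrow> nat \<Rightarrow> 'a set" where
  "multivectors K V r = {sum_list bs | bs. set bs \<subseteq> blades K V r}"

definition grade_decomposition :: "'a::ring_1 set \<Rightarrow> 'a set \<Rightarrow> 'a \<Rightarrow> (nat \<Rightarrow> 'a) \<Rightarrow> bool" where
  "grade_decomposition K V A f \<longleftrightarrow>
     (\<forall>r. f r \<in> multivectors K V r) \<and> finite {r. f r \<noteq> 0} \<and> A = (\<Sum>r | f r \<noteq> 0. f r)"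

definition grade_part :: "'a::ring_1 set \<Rightarrow> 'a set \<Rightarrow> 'a \<Rightarrow> nat \<Rightarrow> 'a" where
  "grade_part K V A = (THE f. grade_decomposition K V A f)"

locale geometric_algebra =
  fixes K V :: "'a::ring_1 set"
  assumes scalar_0: "0 \<in> K"
    and scalar_1: "1 \<in> K"
    and scalar_add: "a \<in> K \<Longrightarrow> b \<in> K \<Longrightarrow> a + b \<in> K"
    and scalar_uminus: "a \<in> K \<Longrightarrow> - a \<in> K"
    and scalar_mult: "a \<in> K \<Longrightarrow> b \<in> K \<Longrightarrow> a * b \<in> K"
    and scalar_commute: "a \<in> K \<Longrightarrow> b \<in> K \<Longrightarrow> a * b = b * a"
    and scalar_inverse_ex: "a \<in> K \<Longrightarrow> a \<noteq> 0 \<Longrightarrow> \<exists>b\<in>K. a * b = 1"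
    and scalar_char_0: "n > 0 \<Longrightarrow> of_nat n \<noteq> (0::'a)"
    and vector_0: "0 \<in> V"
    and vector_add: "u \<in> V \<Longrightarrow> v \<in> V \<Longrightarrow> u + v \<in> V"
    and vector_scale: "a \<in> K \<Longrightarrow> v \<in> V \<Longrightarrow> a * v \<in> V"
    and scalar_vector_commute: "a \<in> K \<Longrightarrow> v \<in> V \<Longrightarrow> a * v = v * a"
    and vector_square: "v \<in> V \<Longrightarrow> v * v \<in> K"
    and nondegenerate: "u \<in> V \<Longrightarrow> (\<And>v. v \<in> V \<Longrightarrow> vec_orthogonal K u v) \<Longrightarrow> u = 0"
    and direct_sum: "\<exists>!f. grade_decomposition K V A f"
begin

lemma two_times_half: "2 * scalar_inverse K 2 = 1"
  and half_scalar: "scalar_inverse K 2 \<in> K"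
proof -
  have two: "(2::'a) \<in> K"
    using scalar_add[OF scalar_1 scalar_1] by simp
  have "(2::'a) \<noteq> 0"
    using scalar_char_0[of 2] by simp
  then obtain h where h: "h \<in> K" "2 * h = 1"
    using scalar_inverse_ex two by blast
  have "y = h" if "y \<in> K" "2 * y = 1" for y
  proof -
    have "y = y * (2 * h)" using h by simp
    also have "\<dots> = 2 * y * h" using scalar_commute[OF that(1) two] by (simp add: mult.assoc[symmetric])
    finally show ?thesis using that by simp
  qed
  then have "scalar_inverse K 2 = h"
    unfolding scalar_inverse_def using h by blast
  with h show "2 * scalar_inverse K 2 = 1" "scalar_inverse K 2 \<in> K" by auto
qed

lemma vec_inner_scalar:
  assumes "u \<in> V" "v \<in> V"
  shows "vec_inner K u v \<in> K"
proof -
  have "u * v + v * u = (u + v) * (u + v) + (- (u * u) + - (v * v))"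
    by (simp add: algebra_simps)
  also have "\<dots> \<in> K"
    using assms by (intro scalar_add scalar_uminus vector_square vector_add)
  finally show ?thesis
    unfolding vec_inner_def by (intro scalar_mult half_scalar)
qed

end

end

theory Submission
  imports Defs
begin

text \<open>
  Any two blades have all their factors in the span of one finite set \<open>W\<close> of pairwise orthogonal
  vectors, null vectors being allowed. If \<open>v\<close> is orthogonal to the factors of an \<open>r\<close>-blade \<open>X\<close>, then
  \<open>2 v X = v X + (-1)^r X v\<close>, and the right-hand side maps products of \<open>r\<close> distinct elements of \<open>W\<close>
  to combinations of products of \<open>r + 1\<close> distinct elements. So an \<open>r\<close>-blade is a combination of
  products of \<open>r\<close> distinct elements of \<open>W\<close>. The product of two such monomials with index sets
  \<open>S\<close> and \<open>T\<close> is a scalar times the monomial of the symmetric difference, whose cardinality is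
  \<open>|S| + |T| - 2 |S \<inter> T|\<close>.
\<close>

context geometric_algebra
begin

section \<open>Linear combinations with scalar coefficients\<close>

text \<open>The span of \<open>S\<close> over \<open>K\<close>, built one term at a time so that
  linearity arguments become rule inductions.\<close>

inductive_set lin :: "'a set \<Rightarrow> 'a set" for S where
  zero: "0 \<in> lin S"
| add: "c \<in> K \<Longrightarrow> x \<in> S \<Longrightarrow> y \<in> lin S \<Longrightarrow> c * x + y \<in> lin S"

lemma lin_add: "x \<in> lin S \<Longrightarrow> y \<in> lin S \<Longrightarrow> x + y \<in> lin S"
  by (induction rule: lin.induct) (auto simp: add.assoc intro: lin.add)

lemma lin_scale: "x \<in> lin S \<Longrightarrow> c \<in> K \<Longrightarrow> c * x \<in> lin S"
proof (induction rule: lin.induct)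
  case (add d x y)
  have "(c * d) * x + c * y \<in> lin S"
    using add by (intro lin.add scalar_mult) auto
  then show ?case by (simp add: algebra_simps)
qed (simp add: lin.zero)

lemma lin_base: "x \<in> S \<Longrightarrow> x \<in> lin S"
  using lin.add[OF scalar_1 _ lin.zero] by simp

lemma lin_subsetI:
  assumes "S \<subseteq> P" "0 \<in> P" "\<And>x y. x \<in> P \<Longrightarrow> y \<in> P \<Longrightarrow> x + y \<in> P"
    and "\<And>c x. c \<in> K \<Longrightarrow> x \<in> P \<Longrightarrow> c * x \<in> P"
  shows "lin S \<subseteq> P"
proof
  fix x assume "x \<in> lin S"
  then show "x \<in> P" by induction (use assms in auto)
qed

lemma lin_trans: "S \<subseteq> lin T \<Longrightarrow> lin S \<subseteq> lin T"
  by (rule lin_subsetI) (auto intro: lin.zero lin_add lin_scale)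

lemma lin_mono: "S \<subseteq> T \<Longrightarrow> lin S \<subseteq> lin T"
  by (rule lin_trans) (auto intro: lin_base)

lemma lin_uminus: "x \<in> lin S \<Longrightarrow> - x \<in> lin S"
  using lin_scale[of x S "-1"] scalar_uminus[OF scalar_1] by simp

lemma lin_vectors: "S \<subseteq> V \<Longrightarrow> lin S \<subseteq> V"
  by (rule lin_subsetI) (auto intro: vector_0 vector_add vector_scale)

section \<open>Blades, multivectors and the centrality of scalars\<close>

lemma scalar_prod_list_commute:
  assumes "c \<in> K" "set vs \<subseteq> V"
  shows "c * prod_list vs = prod_list vs * c"
  using assms(2)
proof (induction vs)
  case (Cons v vs)
  have "c * (v * prod_list vs) = v * (c * prod_list vs)"
    using Cons.prems scalar_vector_commute[OF assms(1), of v] by (simp add: mult.assoc[symmetric])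
  then show ?case using Cons by (simp add: mult.assoc)
qed simp

text \<open>The factor 1/2 of the inner product is invertible, so orthogonality is plain
  anticommutation.\<close>

lemma orthogonal_iff: "vec_orthogonal K u v \<longleftrightarrow> u * v + v * u = 0"
proof -
  have "u * v + v * u = 2 * (scalar_inverse K 2 * (u * v + v * u))"
    using two_times_half by (simp add: mult.assoc[symmetric])
  then show ?thesis
    unfolding vec_orthogonal_def vec_inner_def by (metis mult_zero_right)
qed

lemma orthogonal_sym: "vec_orthogonal K u v \<longleftrightarrow> vec_orthogonal K v u"
  by (simp add: orthogonal_iff add.commute)

text \<open>One normal form for all grades: for \<open>r = 0\<close> the list is empty and
  \<open>c\<close> is the scalar itself, otherwise \<open>c = 1\<close> works. Since orthogonality
  is symmetric, \<open>sorted_wrt\<close> expresses it pairwise in a form suited to list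
  induction.\<close>

lemma blade_cases:
  assumes "b \<in> blades K V r"
  obtains c vs where "c \<in> K" "set vs \<subseteq> V" "length vs = r"
    "sorted_wrt (vec_orthogonal K) vs" "b = c * prod_list vs"
proof -
  consider "r = 0" | "r = 1" | "r > 1" by linarith
  then show ?thesis
  proof cases
    case 1
    then show ?thesis using assms that[of b "[]"] by (simp add: blades_def)
  next
    case 2
    then show ?thesis using assms that[of 1 "[b]"] by (simp add: blades_def scalar_1)
  next
    case 3
    then obtain vs where "b = prod_list vs" "length vs = r" "set vs \<subseteq> V"
      "\<forall>i<r. \<forall>j<r. i \<noteq> j \<longrightarrow> vec_orthogonal K (vs ! i) (vs ! j)"
      using assms by (auto simp: blades_def)
    then show ?thesis
      using that[of 1 vs] by (simp add: scalar_1 sorted_wrt_iff_nth_less)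
  qed
qed

lemma prod_list_in_blades:
  assumes "set vs \<subseteq> V" "sorted_wrt (vec_orthogonal K) vs"
  shows "prod_list vs \<in> blades K V (length vs)"
proof -
  consider "length vs = 0" | "length vs = 1" | "length vs > 1" by linarith
  then show ?thesis
  proof cases
    case 1
    then show ?thesis by (simp add: blades_def scalar_1)
  next
    case 2
    then show ?thesis using assms by (auto simp: blades_def length_Suc_conv)
  next
    case 3
    have "vec_orthogonal K (vs ! i) (vs ! j)" if "i < length vs" "j < length vs" "i \<noteq> j" for i j
      using that assms(2) orthogonal_sym
      by (metis linorder_neqE_nat sorted_wrt_iff_nth_less)
    then show ?thesis using assms 3 unfolding blades_def by auto
  qed
qed

text \<open>The scalar is absorbed into the first factor, which remains a vector orthogonal to the
  others. Without factors the blade is itself a scalar.\<close>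

lemma blades_scale:
  assumes "c \<in> K" "b \<in> blades K V r"
  shows "c * b \<in> blades K V r"
proof -
  obtain d vs where b: "d \<in> K" "set vs \<subseteq> V" "length vs = r"
    "sorted_wrt (vec_orthogonal K) vs" "b = d * prod_list vs"
    using blade_cases[OF assms(2)] by metis
  have cd: "c * d \<in> K" using assms b by (simp add: scalar_mult)
  show ?thesis
  proof (cases vs)
    case Nil
    then show ?thesis using b cd by (auto simp: blades_def)
  next
    case (Cons v ws)
    have v: "v \<in> V" using b Cons by simp
    have "vec_orthogonal K (c * d * v) w" if "w \<in> set ws" for w
    proof -
      have w: "w \<in> V" "v * w + w * v = 0"
        using that b Cons by (auto simp: orthogonal_iff)
      have "w * (c * d * v) = c * d * (w * v)"
        using scalar_vector_commute[OF cd w(1)] by (metis mult.assoc)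
      then have "c * d * v * w + w * (c * d * v) = c * d * (v * w + w * v)"
        by (simp add: distrib_left mult.assoc)
      then show ?thesis using w by (simp add: orthogonal_iff)
    qed
    then have "prod_list ((c * d * v) # ws) \<in> blades K V (length ((c * d * v) # ws))"
      using b Cons by (intro prod_list_in_blades) (auto intro: vector_scale cd)
    then show ?thesis using b Cons by (simp add: mult.assoc)
  qed
qed

lemma multivectors_zero: "0 \<in> multivectors K V r"
  unfolding multivectors_def by (auto intro: exI[of _ "[]"])

lemma multivectors_add:
  assumes "A \<in> multivectors K V r" "B \<in> multivectors K V r"
  shows "A + B \<in> multivectors K V r"
proof -
  obtain as bs where "A = sum_list as" "set as \<subseteq> blades K V r"
    "B = sum_list bs" "set bs \<subseteq> blades K V r"
    using assms unfolding multivectors_def by auto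
  then show ?thesis
    unfolding multivectors_def by (auto intro!: exI[of _ "as @ bs"])
qed

lemma multivectors_scale:
  assumes "c \<in> K" "A \<in> multivectors K V r"
  shows "c * A \<in> multivectors K V r"
proof -
  obtain as where "A = sum_list as" "set as \<subseteq> blades K V r"
    using assms unfolding multivectors_def by auto
  moreover from this have "set (map ((*) c) as) \<subseteq> blades K V r"
    using blades_scale[OF assms(1)] by fastforce
  ultimately show ?thesis
    unfolding multivectors_def by (auto intro!: exI[of _ "map ((*) c) as"] simp: sum_list_const_mult)
qed

lemma blades_subset_multivectors: "blades K V r \<subseteq> multivectors K V r"
proof
  fix b assume "b \<in> blades K V r"
  then show "b \<in> multivectors K V r"
    unfolding multivectors_def by (auto intro!: exI[of _ "[b]"])
qed

text \<open>Scalars are only assumed to commute with scalars and vectors. This passes to products of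
  vectors, hence to blades and their sums, and \<open>direct_sum\<close> makes every element a
  finite sum of blades.\<close>

lemma scalar_central:
  assumes "c \<in> K"
  shows "c * A = A * c"
proof -
  have blade: "c * b = b * c" if "b \<in> blades K V r" for b r
  proof -
    obtain d vs where b: "d \<in> K" "set vs \<subseteq> V" "b = d * prod_list vs"
      using blade_cases[OF \<open>b \<in> blades K V r\<close>] by metis
    then show ?thesis
      using scalar_prod_list_commute[OF assms b(2)] scalar_commute[OF assms b(1)]
      by (metis mult.assoc)
  qed
  have multi: "c * M = M * c" if M: "M \<in> multivectors K V r" for M r
  proof -
    obtain bs where bs: "M = sum_list bs" "set bs \<subseteq> blades K V r"
      using M unfolding multivectors_def by auto
    from bs(2) have "c * sum_list bs = sum_list bs * c"
      by (induction bs) (auto simp: distrib_left distrib_right blade)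
    then show ?thesis using bs by simp
  qed
  obtain f where f: "grade_decomposition K V A f" using direct_sum by blast
  then have A: "A = (\<Sum>r | f r \<noteq> 0. f r)" and "\<And>r. f r \<in> multivectors K V r"
    unfolding grade_decomposition_def by auto
  then have "c * f r = f r * c" for r using multi by blast
  then show ?thesis by (subst (1 2) A) (simp add: sum_distrib_left sum_distrib_right)
qed

lemma scalar_left_commute: "c \<in> K \<Longrightarrow> A * (c * B) = c * (A * B)"
  using scalar_central[of c A] by (metis mult.assoc)

section \<open>Orthogonal generators for a finite set of vectors\<close>

lemma orthogonal_lin:
  assumes "X \<in> lin S" "\<And>x. x \<in> S \<Longrightarrow> vec_orthogonal K a x"
  shows "vec_orthogonal K a X"
  using assms(1)
proof induction
  case zero
  then show ?case by (simp add: orthogonal_iff)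
next
  case (add c x y)
  then have "a * x + x * a = 0" "a * y + y * a = 0"
    using assms(2) by (auto simp: orthogonal_iff)
  moreover have "a * (c * x + y) + (c * x + y) * a = c * (a * x + x * a) + (a * y + y * a)"
    by (simp add: distrib_left distrib_right scalar_left_commute[OF add.hyps(1)] mult.assoc)
  ultimately show ?case by (simp add: orthogonal_iff)
qed

text \<open>One Gram-Schmidt step: the nonzero scalar \<open>n * n\<close> is invertible, so the
  component of \<open>w\<close> along \<open>n\<close> can be removed.\<close>

lemma ex_orthogonal_projection:
  assumes "n \<in> V" "w \<in> V" "n * n \<noteq> 0"
  shows "\<exists>c\<in>K. vec_orthogonal K n (w + c * n)"
proof -
  have two: "(2::'a) \<in> K" using scalar_add[OF scalar_1 scalar_1] by simp
  obtain d where d: "d \<in> K" "n * n * d = 1"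
    using scalar_inverse_ex[OF vector_square[OF assms(1)] assms(3)] by blast
  define h where "h = scalar_inverse K 2"
  have h: "h \<in> K" "2 * h = 1" unfolding h_def using half_scalar two_times_half by auto
  define i where "i = vec_inner K n w"
  have i: "i \<in> K" "n * w + w * n = 2 * i"
    using vec_inner_scalar[OF assms(1,2)] two_times_half
    by (auto simp: i_def vec_inner_def mult.assoc[symmetric])
  \<comment> \<open>\<open>i\<close> is the inner product of \<open>n\<close> and \<open>w\<close>,
    and \<open>d\<close> is the inverse of \<open>n * n\<close>; so \<open>c * n\<close> is minus
    the projection of \<open>w\<close> onto \<open>n\<close>.\<close>
  define c where "c = - (i * d)"
  have c: "c \<in> K" unfolding c_def using i d by (intro scalar_uminus scalar_mult)
  have "c * (n * n) = - i"
    using d scalar_central[OF d(1), of "n * n"] by (simp add: c_def mult.assoc)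
  then have "n * (w + c * n) + (w + c * n) * n = (n * w + w * n) + (- i - i)"
    using c by (simp add: distrib_left distrib_right scalar_left_commute mult.assoc)
  also have "\<dots> = 0" using i by (simp add: mult_2)
  finally show ?thesis using c by (auto simp: orthogonal_iff)
qed

text \<open>If two generators are not orthogonal, one of them or their sum is non-null; the other
  generators are made orthogonal to this vector.\<close>

lemma ex_orthogonal_generators:
  assumes "finite S" "S \<subseteq> V"
  shows "\<exists>W. pairwise (vec_orthogonal K) W \<and> W \<subseteq> lin S \<and> S \<subseteq> lin W"
  using assms
proof (induction "card S" arbitrary: S rule: less_induct)
  case less
  show ?case
  proof (cases "pairwise (vec_orthogonal K) S")
    case True
    then show ?thesis by (auto intro: lin_base)
  next
    case False
    then obtain u v where uv: "u \<in> S" "v \<in> S" "u \<noteq> v" "u * v + v * u \<noteq> 0"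
      by (auto simp: pairwise_def orthogonal_iff)
    \<comment> \<open>\<open>x\<close> is the generator that \<open>n\<close> replaces:
      \<open>n\<close> itself if \<open>n\<close> is \<open>u\<close> or \<open>v\<close>, and
      \<open>u\<close> if \<open>n = u + v\<close>.\<close>
    have "\<exists>n x. n * n \<noteq> 0 \<and> n \<in> lin S \<and> x \<in> S \<and> x \<in> lin (insert n (S - {x}))"
    proof (cases "u * u = 0 \<and> v * v = 0")
      case False
      then show ?thesis using uv by (metis insertI1 lin_base)
    next
      case True
      have "(u + v) * (u + v) = u * v + v * u" using True by (simp add: algebra_simps)
      moreover have "(u + v) + - v \<in> lin (insert (u + v) (S - {u}))"
        using uv by (intro lin_add lin_uminus lin_base) auto
      ultimately show ?thesis using uv
        by (intro exI[of _ "u + v"] exI[of _ u]) (auto intro: lin_add lin_base)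
    qed
    then obtain n x where n: "n * n \<noteq> 0" "n \<in> lin S" "x \<in> S" "x \<in> lin (insert n (S - {x}))"
      by blast
    have nV: "n \<in> V" using n(2) lin_vectors less.prems by blast
    have "\<forall>w\<in>S - {x}. \<exists>c. c \<in> K \<and> vec_orthogonal K n (w + c * n)"
      using ex_orthogonal_projection[OF nV _ n(1)] less.prems by blast
    then obtain c where c: "\<And>w. w \<in> S - {x} \<Longrightarrow> c w \<in> K \<and> vec_orthogonal K n (w + c w * n)"
      by metis
    define T where "T = (\<lambda>w. w + c w * n) ` (S - {x})"
    \<comment> \<open>The projection may identify some generators, which only helps:
      \<open>T\<close> is smaller than \<open>S\<close> because \<open>x\<close> has been
      dropped.\<close>
    have "card T \<le> card (S - {x})"
      unfolding T_def using less.prems by (intro card_image_le) auto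
    also have "\<dots> < card S" using n less.prems by (intro card_Diff1_less)
    finally have "card T < card S" .
    moreover have "finite T" unfolding T_def using less.prems by auto
    moreover have T_lin: "T \<subseteq> lin S"
      unfolding T_def using c n(2) by (auto intro!: lin_add lin_scale intro: lin_base)
    moreover have "T \<subseteq> V" using T_lin lin_vectors less.prems by blast
    ultimately obtain W where W: "pairwise (vec_orthogonal K) W" "W \<subseteq> lin T" "T \<subseteq> lin W"
      using less.hyps by blast
    have nT: "vec_orthogonal K n y" if "y \<in> T" for y
      using that c unfolding T_def by auto
    have nW: "vec_orthogonal K n y" if "y \<in> W" for y
      by (rule orthogonal_lin[of _ T]) (use that W nT in auto)
    have "pairwise (vec_orthogonal K) (insert n W)"
      using W(1) nW orthogonal_sym by (auto simp: pairwise_insert)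
    moreover have "insert n W \<subseteq> lin S"
      using n W(2) lin_trans[OF T_lin] by blast
    \<comment> \<open>Undoing the projection recovers every generator except \<open>x\<close>, and
      \<open>x\<close> is a combination of these and \<open>n\<close>.\<close>
    moreover have "S \<subseteq> lin (insert n W)"
    proof -
      have n': "n \<in> lin (insert n W)" by (auto intro: lin_base)
      have rest: "w \<in> lin (insert n W)" if w: "w \<in> S - {x}" for w
      proof -
        have "w + c w * n \<in> lin (insert n W)"
          using w W(3) lin_mono[of W "insert n W"] unfolding T_def by blast
        moreover have "- (c w * n) \<in> lin (insert n W)"
          using c[OF w] n' by (intro lin_uminus lin_scale) auto
        ultimately have "(w + c w * n) + - (c w * n) \<in> lin (insert n W)" by (rule lin_add)
        then show ?thesis by simp
      qed
      then have "lin (insert n (S - {x})) \<subseteq> lin (insert n W)"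
        using n' by (intro lin_trans) auto
      then show ?thesis using n(4) rest by auto
    qed
    ultimately show ?thesis by blast
  qed
qed

section \<open>Monomials in an orthogonal set\<close>

definition monomials :: "'a set \<Rightarrow> nat \<Rightarrow> 'a set" where
  "monomials W r = {prod_list xs | xs. distinct xs \<and> set xs \<subseteq> W \<and> length xs = r}"

lemma monomialsI: "distinct xs \<Longrightarrow> set xs \<subseteq> W \<Longrightarrow> length xs = r \<Longrightarrow> prod_list xs \<in> monomials W r"
  by (auto simp: monomials_def)

lemma sign_scalar: "(- 1) ^ n \<in> K"
  by (cases "even n") (auto intro: scalar_1 scalar_uminus)

text \<open>Passing \<open>x\<close> across each factor costs one sign.\<close>

lemma orthogonal_prod_list_commute:
  assumes "\<And>y. y \<in> set xs \<Longrightarrow> vec_orthogonal K x y"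
  shows "x * prod_list xs = (- 1) ^ length xs * (prod_list xs * x)"
  using assms
proof (induction xs)
  case (Cons y ys)
  have "x * y = - (y * x)" using Cons.prems by (simp add: orthogonal_iff eq_neg_iff_add_eq_0)
  then have "x * (y * prod_list ys) = - (y * (x * prod_list ys))"
    by (simp add: mult.assoc[symmetric])
  then show ?case
    using Cons by (simp add: scalar_left_commute[OF sign_scalar] mult.assoc)
qed simp

text \<open>A new factor is prepended. A factor that already occurs is moved up to its other copy,
  where the two contract to the scalar \<open>x * x\<close>, which is zero for a null
  vector.\<close>

lemma vector_mult_monomial:
  assumes "W \<subseteq> V" "pairwise (vec_orthogonal K) W"
    and "x \<in> W" "distinct xs" "set xs \<subseteq> W"
  shows "\<exists>c\<in>K. \<exists>zs. distinct zs \<and> set zs = sym_diff {x} (set xs) \<and>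
    x * prod_list xs = c * prod_list zs"
proof (cases "x \<in> set xs")
  case False
  then show ?thesis
    using assms by (intro bexI[of _ 1] exI[of _ "x # xs"]) (auto intro: scalar_1)
next
  case True
  then obtain ys zs where xs: "xs = ys @ x # zs" by (meson split_list)
  have "x * prod_list ys = (- 1) ^ length ys * (prod_list ys * x)"
    using assms xs by (intro orthogonal_prod_list_commute pairwiseD[OF assms(2)]) auto
  then have "x * prod_list xs = (- 1) ^ length ys * (prod_list ys * (x * x * prod_list zs))"
    unfolding xs by (simp add: mult.assoc[symmetric])
  also have "\<dots> = ((- 1) ^ length ys * (x * x)) * prod_list (ys @ zs)"
    using assms by (subst scalar_left_commute) (auto intro!: vector_square simp: mult.assoc)
  finally have "x * prod_list xs = ((- 1) ^ length ys * (x * x)) * prod_list (ys @ zs)" .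
  moreover have "(- 1) ^ length ys * (x * x) \<in> K"
    using assms by (auto intro!: scalar_mult sign_scalar vector_square)
  moreover have "distinct (ys @ zs)" "set (ys @ zs) = sym_diff {x} (set xs)"
    using assms xs by auto
  ultimately show ?thesis by blast
qed

text \<open>The factors of the left monomial are multiplied in one at a time; each toggles the
  membership of one element in the index set.\<close>

lemma monomial_mult_monomial:
  assumes "W \<subseteq> V" "pairwise (vec_orthogonal K) W"
    and "distinct xs" "set xs \<subseteq> W" "distinct ys" "set ys \<subseteq> W"
  shows "\<exists>c\<in>K. \<exists>zs. distinct zs \<and> set zs = sym_diff (set xs) (set ys) \<and>
    prod_list xs * prod_list ys = c * prod_list zs"
  using assms(3,4)
proof (induction xs)
  case Nil
  then show ?case
    using assms by (intro bexI[of _ 1] exI[of _ ys]) (auto intro: scalar_1)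
next
  case (Cons x xs)
  then obtain c zs where zs: "c \<in> K" "distinct zs" "set zs = sym_diff (set xs) (set ys)"
    "prod_list xs * prod_list ys = c * prod_list zs" by auto
  moreover have "set zs \<subseteq> W" using zs Cons.prems assms by auto
  ultimately obtain d us where us: "d \<in> K" "distinct us" "set us = sym_diff {x} (set zs)"
    "x * prod_list zs = d * prod_list us"
    using vector_mult_monomial[OF assms(1,2), of x zs] Cons.prems by auto
  have "prod_list (x # xs) * prod_list ys = (c * d) * prod_list us"
    using zs us by (simp add: mult.assoc scalar_left_commute)
  moreover have "set us = sym_diff (set (x # xs)) (set ys)"
    using us(3) zs(3) Cons.prems by auto
  ultimately show ?case using us zs scalar_mult by blast
qed

text \<open>The expression is twice the exterior product of \<open>x\<close> and \<open>X\<close>.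
  If \<open>x\<close> is not a factor of \<open>X\<close>, both terms equal \<open>x * X\<close>; if
  it is, they cancel.\<close>

lemma graded_anticommutator_monomial:
  assumes "pairwise (vec_orthogonal K) W" "x \<in> W" "X \<in> monomials W r"
  shows "x * X + (- 1) ^ r * (X * x) \<in> lin (monomials W (Suc r))"
proof -
  obtain xs where xs: "X = prod_list xs" "distinct xs" "set xs \<subseteq> W" "length xs = r"
    using assms(3) by (auto simp: monomials_def)
  show ?thesis
  proof (cases "x \<in> set xs")
    case False
    then have "x * prod_list xs = (- 1) ^ length xs * (prod_list xs * x)"
      using assms(2) xs by (intro orthogonal_prod_list_commute pairwiseD[OF assms(1)]) auto
    then have "x * X = (- 1) ^ r * (X * x)" by (simp add: xs)
    moreover have "x * X \<in> lin (monomials W (Suc r))"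
      using monomialsI[of "x # xs" W "Suc r"] assms xs False by (auto intro: lin_base)
    ultimately show ?thesis by (metis lin_add)
  next
    case True
    then obtain ys zs where split: "xs = ys @ x # zs" by (meson split_list)
    define Y Z where "Y = prod_list ys" and "Z = prod_list zs"
    have ys: "x * Y = (- 1) ^ length ys * (Y * x)"
      unfolding Y_def using assms xs split
      by (intro orthogonal_prod_list_commute pairwiseD[OF assms(1)]) auto
    have zs: "x * Z = (- 1) ^ length zs * (Z * x)"
      unfolding Z_def using assms xs split
      by (intro orthogonal_prod_list_commute pairwiseD[OF assms(1)]) auto
    have X: "X = Y * (x * Z)" using xs split by (simp add: Y_def Z_def)
    have "x * X = (- 1) ^ length ys * (Y * x) * (x * Z)"
      unfolding X using ys by (simp add: mult.assoc[symmetric])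
    also have "\<dots> = (- 1) ^ length ys * (Y * (x * (x * Z)))"
      by (simp add: mult.assoc)
    also have "Y * (x * (x * Z)) = (- 1) ^ length zs * (X * x)"
      unfolding X by (subst zs) (simp add: mult.assoc scalar_left_commute[OF sign_scalar])
    finally have "x * X = (- 1) ^ (length ys + length zs) * (X * x)"
      by (simp add: power_add mult.assoc)
    \<comment> \<open>\<open>x\<close> anticommutes with all factors but its own copy, so there are
      \<open>r - 1\<close> signs, opposite in parity to \<open>r\<close>.\<close>
    then have "x * X + (- 1) ^ r * (X * x) = 0"
      using xs(4)[symmetric] split by simp
    then show ?thesis by (simp add: lin.zero)
  qed
qed

lemma graded_anticommutator_lin:
  assumes "pairwise (vec_orthogonal K) W" "v \<in> lin W" "X \<in> lin (monomials W r)"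
  shows "v * X + (- 1) ^ r * (X * v) \<in> lin (monomials W (Suc r))"
proof -
  have x: "x * X + (- 1) ^ r * (X * x) \<in> lin (monomials W (Suc r))" if "x \<in> W" for x
    using assms(3)
  proof induction
    case zero
    then show ?case by (simp add: lin.zero)
  next
    case (add c y z)
    have "x * (c * y + z) + (- 1) ^ r * ((c * y + z) * x)
      = c * (x * y + (- 1) ^ r * (y * x)) + (x * z + (- 1) ^ r * (z * x))"
      by (simp add: distrib_left distrib_right scalar_left_commute[OF add.hyps(1)] mult.assoc)
    also have "\<dots> \<in> lin (monomials W (Suc r))"
      by (rule lin_add[OF lin_scale[OF graded_anticommutator_monomial[OF assms(1) that add.hyps(2)]
            add.hyps(1)] add.IH])
    finally show ?case .
  qed
  from assms(2) show ?thesis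
  proof induction
    case zero
    then show ?case by (simp add: lin.zero)
  next
    case (add c y z)
    have "(c * y + z) * X + (- 1) ^ r * (X * (c * y + z))
      = c * (y * X + (- 1) ^ r * (X * y)) + (z * X + (- 1) ^ r * (X * z))"
      by (simp add: distrib_left distrib_right scalar_left_commute[OF add.hyps(1)] mult.assoc)
    also have "\<dots> \<in> lin (monomials W (Suc r))"
      by (rule lin_add[OF lin_scale[OF x[OF add.hyps(2)] add.hyps(1)] add.IH])
    finally show ?case .
  qed
qed

text \<open>Expanding \<open>v * X\<close> directly over \<open>W\<close> could also produce
  monomials of degree one lower than that of \<open>X\<close>. Orthogonality of \<open>v\<close> to
  the factors of \<open>X\<close> turns \<open>v * X\<close> into half the graded anticommutator,
  which only raises the degree.\<close>

lemma orthogonal_prod_list_in_lin_monomials: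
  assumes "pairwise (vec_orthogonal K) W"
    and "set vs \<subseteq> lin W" "sorted_wrt (vec_orthogonal K) vs"
  shows "prod_list vs \<in> lin (monomials W (length vs))"
  using assms(2,3)
proof (induction vs)
  case Nil
  then show ?case using monomialsI[of "[]" W 0] by (auto intro: lin_base)
next
  case (Cons v vs)
  define X where "X = prod_list vs"
  have "v * X = (- 1) ^ length vs * (X * v)"
    using Cons.prems orthogonal_prod_list_commute[of vs v] by (simp add: X_def)
  moreover have "v * X + (- 1) ^ length vs * (X * v) \<in> lin (monomials W (Suc (length vs)))"
    using Cons unfolding X_def by (intro graded_anticommutator_lin[OF assms(1)]) auto
  ultimately have "2 * (v * X) \<in> lin (monomials W (Suc (length vs)))"
    by (simp add: mult_2)
  then have "scalar_inverse K 2 * (2 * (v * X)) \<in> lin (monomials W (Suc (length vs)))"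
    by (rule lin_scale[OF _ half_scalar])
  moreover have "scalar_inverse K 2 * (2 * (v * X)) = v * X"
    using two_times_half scalar_central[OF half_scalar, of 2] by (simp add: mult.assoc[symmetric])
  ultimately show ?case by (simp add: X_def)
qed

section \<open>Grades occurring in a product\<close>

text \<open>The sum of the grade subspaces indexed by a finite \<open>J\<close>. The family
  \<open>g\<close> is constrained at every index, so families can be added and scaled without regard
  to \<open>J\<close>.\<close>

definition grade_sums :: "nat set \<Rightarrow> 'a set" where
  "grade_sums J = {\<Sum>k\<in>J. g k | g. \<forall>k. g k \<in> multivectors K V k}"

lemma grade_sums_zero: "0 \<in> grade_sums J"
  unfolding grade_sums_def by (auto intro!: exI[of _ "\<lambda>_. 0"] simp: multivectors_zero)

lemma grade_sums_add: "x \<in> grade_sums J \<Longrightarrow> y \<in> grade_sums J \<Longrightarrow> x + y \<in> grade_sums J"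
  unfolding grade_sums_def
proof clarsimp
  fix f g assume "\<forall>k. f k \<in> multivectors K V k" "\<forall>k. g k \<in> multivectors K V k"
  then show "\<exists>h. sum f J + sum g J = sum h J \<and> (\<forall>k. h k \<in> multivectors K V k)"
    by (intro exI[of _ "\<lambda>k. f k + g k"]) (auto simp: sum.distrib multivectors_add)
qed

lemma grade_sums_scale: "c \<in> K \<Longrightarrow> x \<in> grade_sums J \<Longrightarrow> c * x \<in> grade_sums J"
  unfolding grade_sums_def
proof clarsimp
  fix f assume "c \<in> K" "\<forall>k. f k \<in> multivectors K V k"
  then show "\<exists>h. c * sum f J = sum h J \<and> (\<forall>k. h k \<in> multivectors K V k)"
    by (intro exI[of _ "\<lambda>k. c * f k"]) (auto simp: sum_distrib_left multivectors_scale)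
qed

lemma multivector_in_grade_sums:
  assumes "finite J" "k \<in> J" "x \<in> multivectors K V k"
  shows "x \<in> grade_sums J"
proof -
  have "x = (\<Sum>i\<in>J. if i = k then x else 0)" using assms by simp
  then show ?thesis
    unfolding grade_sums_def
    using assms(3) multivectors_zero by (auto intro!: exI[of _ "\<lambda>i. if i = k then x else 0"])
qed

definition product_grades :: "nat \<Rightarrow> nat \<Rightarrow> nat set" where
  "product_grades r s = (\<lambda>j. nat \<bar>int r - int s\<bar> + 2 * j) ` {0..min r s}"

text \<open>With \<open>i\<close> common elements the cardinality is
  \<open>card S + card T - 2 * i\<close>, so the index is
  \<open>j = min (card S) (card T) - i\<close>: nested sets give \<open>j = 0\<close>, disjoint sets
  the largest \<open>j\<close>.\<close>

lemma card_sym_diff_in_product_grades: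
  assumes "finite S" "finite T"
  shows "card (sym_diff S T) \<in> product_grades (card S) (card T)"
proof -
  define i where "i = card (S \<inter> T)"
  have i: "i \<le> card S" "i \<le> card T"
    unfolding i_def using assms by (auto intro: card_mono)
  have "card (sym_diff S T) = card (S - T) + card (T - S)"
    using assms by (intro card_Un_disjoint) auto
  also have "\<dots> = (card S - i) + (card T - i)"
    using assms by (simp add: i_def card_Diff_subset_Int Int_commute)
  also have "\<dots> = nat \<bar>int (card S) - int (card T)\<bar> + 2 * (min (card S) (card T) - i)"
    using i by (auto simp: min_def nat_diff_distrib)
  finally show ?thesis
    unfolding product_grades_def
    by (intro image_eqI[of _ _ "min (card S) (card T) - i"]) auto
qed

text \<open>Such a product is a scalar times one monomial. Distinct elements of \<open>W\<close> are
  orthogonal vectors, so this monomial is a blade, whose grade is the size of a symmetric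
  difference.\<close>

lemma monomials_mult_in_grade_sums:
  assumes "W \<subseteq> V" "pairwise (vec_orthogonal K) W"
    and "X \<in> monomials W r" "Y \<in> monomials W s"
  shows "X * Y \<in> grade_sums (product_grades r s)"
proof -
  obtain xs ys where xy: "X = prod_list xs" "distinct xs" "set xs \<subseteq> W" "length xs = r"
    "Y = prod_list ys" "distinct ys" "set ys \<subseteq> W" "length ys = s"
    using assms(3,4) by (auto simp: monomials_def)
  obtain c zs where zs: "c \<in> K" "distinct zs" "set zs = sym_diff (set xs) (set ys)"
    "X * Y = c * prod_list zs"
    using monomial_mult_monomial[OF assms(1,2), of xs ys] xy by auto
  have zW: "set zs \<subseteq> W" using zs(3) xy by auto
  have "sorted_wrt (vec_orthogonal K) zs"
    unfolding sorted_wrt_iff_nth_less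
  proof (intro allI impI)
    fix i j assume ij: "i < j" "j < length zs"
    then have "zs ! i \<in> W" "zs ! j \<in> W" "zs ! i \<noteq> zs ! j"
      using zW zs(2) by (auto simp: nth_eq_iff_index_eq)
    then show "vec_orthogonal K (zs ! i) (zs ! j)"
      using assms(2) by (simp add: pairwise_def)
  qed
  then have "prod_list zs \<in> blades K V (length zs)"
    using zW assms(1) by (intro prod_list_in_blades) auto
  then have "X * Y \<in> multivectors K V (length zs)"
    unfolding zs(4) using blades_subset_multivectors by (intro multivectors_scale[OF zs(1)]) auto
  moreover have "length zs \<in> product_grades r s"
    using card_sym_diff_in_product_grades[of "set xs" "set ys"] zs(2,3) xy
    by (metis List.finite_set distinct_card)
  ultimately show ?thesis
    by (intro multivector_in_grade_sums) (auto simp: product_grades_def)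
qed

text \<open>The factors of both blades are expressed over one common orthogonal set, which reduces
  the claim to products of monomials.\<close>

lemma blades_mult_in_grade_sums:
  assumes "a \<in> blades K V r" "b \<in> blades K V s"
  shows "a * b \<in> grade_sums (product_grades r s)"
proof -
  obtain c us where a: "c \<in> K" "set us \<subseteq> V" "length us = r"
    "sorted_wrt (vec_orthogonal K) us" "a = c * prod_list us"
    using blade_cases[OF assms(1)] by metis
  obtain d vs where b: "d \<in> K" "set vs \<subseteq> V" "length vs = s"
    "sorted_wrt (vec_orthogonal K) vs" "b = d * prod_list vs"
    using blade_cases[OF assms(2)] by metis
  obtain W where W: "pairwise (vec_orthogonal K) W" "W \<subseteq> lin (set us \<union> set vs)"
    "set us \<union> set vs \<subseteq> lin W"
    using ex_orthogonal_generators[of "set us \<union> set vs"] a b by auto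
  have WV: "W \<subseteq> V" using W(2) lin_vectors[of "set us \<union> set vs"] a b by blast
  have us: "prod_list us \<in> lin (monomials W r)" and vs: "prod_list vs \<in> lin (monomials W s)"
    using orthogonal_prod_list_in_lin_monomials[OF W(1)] W(3) a b by auto
  \<comment> \<open>Bilinear expansion in two rounds: the right factor is expanded against a fixed
    monomial, then the left factor.\<close>
  have "X * prod_list vs \<in> grade_sums (product_grades r s)" if X: "X \<in> monomials W r" for X
    using vs
    by induction (auto simp: distrib_left scalar_left_commute
        intro!: grade_sums_zero grade_sums_add grade_sums_scale
          monomials_mult_in_grade_sums[OF WV W(1) X])
  with us have "prod_list us * prod_list vs \<in> grade_sums (product_grades r s)"
    by induction (auto simp: distrib_right mult.assoc
        intro: grade_sums_zero grade_sums_add grade_sums_scale)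
  then have "c * (d * (prod_list us * prod_list vs)) \<in> grade_sums (product_grades r s)"
    by (rule grade_sums_scale[OF a(1) grade_sums_scale[OF b(1)]])
  then show ?thesis using a b by (simp add: mult.assoc scalar_left_commute[OF b(1)])
qed

lemma multivectors_mult_in_grade_sums:
  assumes "A \<in> multivectors K V r" "B \<in> multivectors K V s"
  shows "A * B \<in> grade_sums (product_grades r s)"
proof -
  obtain as bs where A: "A = sum_list as" and as: "set as \<subseteq> blades K V r"
    and B: "B = sum_list bs" and bs: "set bs \<subseteq> blades K V s"
    using assms unfolding multivectors_def by auto
  have "a * sum_list bs \<in> grade_sums (product_grades r s)" if "a \<in> blades K V r" for a
    using bs that by (induction bs)
      (auto simp: distrib_left intro: grade_sums_zero grade_sums_add blades_mult_in_grade_sums)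
  with as show ?thesis
    unfolding A B by (induction as)
      (auto simp: distrib_right intro: grade_sums_zero grade_sums_add)
qed

text \<open>By uniqueness of the grade decomposition, any expression of \<open>x\<close> by
  \<open>k\<close>-vectors with \<open>k\<close> in \<open>J\<close> already consists of the grade
  parts.\<close>

lemma grade_sums_eq_sum_grade_part:
  assumes "finite J" "x \<in> grade_sums J"
  shows "x = (\<Sum>k\<in>J. grade_part K V x k)"
proof -
  obtain g where g: "x = (\<Sum>k\<in>J. g k)" "\<And>k. g k \<in> multivectors K V k"
    using assms(2) unfolding grade_sums_def by auto
  \<comment> \<open>The values of \<open>g\<close> outside \<open>J\<close> are arbitrary; setting
    them to zero gives finite support and a genuine grade decomposition.\<close>
  define f where "f k = (if k \<in> J then g k else 0)" for k
  have sub: "{k. f k \<noteq> 0} \<subseteq> J" by (auto simp: f_def)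
  have x: "x = (\<Sum>k\<in>J. f k)" using g by (simp add: f_def)
  also have "\<dots> = (\<Sum>k | f k \<noteq> 0. f k)"
    using assms(1) sub by (intro sum.mono_neutral_right) auto
  finally have "grade_decomposition K V x f"
    unfolding grade_decomposition_def
    using sub assms(1) g(2) multivectors_zero by (auto simp: f_def intro: finite_subset)
  then have "grade_part K V x = f"
    unfolding grade_part_def using direct_sum[of x] by (rule the1_equality[rotated])
  then show ?thesis using x by simp
qed

end

theorem theorem9:
  fixes K V :: "'a::ring_1 set" and A B :: 'a and r s :: nat
  assumes "geometric_algebra K V"
    and "A \<in> multivectors K V r"
    and "B \<in> multivectors K V s"
  shows "A * B = (\<Sum>j = 0..min r s. grade_part K V (A * B) (nat \<bar>int r - int s\<bar> + 2 * j))"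
proof -
  interpret geometric_algebra K V by fact
  have "A * B = (\<Sum>k\<in>product_grades r s. grade_part K V (A * B) k)"
    using multivectors_mult_in_grade_sums[OF assms(2,3)]
    by (intro grade_sums_eq_sum_grade_part) (auto simp: product_grades_def)
  also have "\<dots> = (\<Sum>j = 0..min r s. grade_part K V (A * B) (nat \<bar>int r - int s\<bar> + 2 * j))"
    unfolding product_grades_def by (subst sum.reindex) (auto simp: inj_on_def)
  finally show ?thesis .
qed

end
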